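(* Let $\mathcal{M}\subseteq\mathbb{R}^N$ be a bounded embedded $C^2$ manifold whose closure $\overline{\mathcal{M}}$ is proximally smooth (of some radius $\delta>0$), and let $\Gamma:\mathcal{M}\rightrightarrows\mathbb{R}^N$ be a multifunction satisfying the Standard Hypotheses (SH) and the Euler arc property. Let $\mathcal{C}\subseteq\mathbb{R}^N$ be closed, and assume there exists a constant $\kappa>0$ such that $$x\in\mathcal{M},\ c\in\mathcal{C}(x)\quad\Rightarrow\quad H_\Gamma(x,x-c)\le \kappa\, d_{\mathcal{C}}(x)^2 .$$ Then for every $x\in\mathcal{M}$ and every trajectory $x(\cdot):[0,T)\to\mathcal{M}$ of $\dot x(t)\in\Gamma(x(t))$ a.e., $x(0)=x$, one has $$d_{\mathcal{C}}(x(t))\le e^{\kappa t}\,d_{\mathcal{C}}(x)\qquad\text{for all } t\in[0,T).$$ In particular, $(\mathcal{M},\Gamma)$ is strongly invariant on $\mathcal{C}$.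
   Context: Distance and projection: $d_{\mathcal{C}}(x)=\inf_{c\in\mathcal{C}}\|c-x\|$ and $\mathcal{C}(x)=\mathrm{proj}_{\mathcal{C}}(x)=\{c\in\mathcal{C}:\|x-c\|=d_{\mathcal{C}}(x)\}$. A closed set $S\subseteq\mathbb{R}^N$ is proximally smooth of radius $\delta>0$ if, for some $\varepsilon>0$, $d_S$ is differentiable on $\{x:0<d_S(x)<\delta+\varepsilon\}$; then points of $\{x: d_S(x)\le\delta\}$ have a unique nearest point in $S$. Maximized Hamiltonian: $H_\Gamma(x,\zeta)=\max_{v\in\Gamma(x)}\langle v,\zeta\rangle$. Standard Hypotheses (SH) for $(\mathcal{M},\Gamma)$: (i) for every $x\in\mathcal{M}$, $\Gamma(x)$ is nonempty, convex, compact and $\Gamma(x)\subseteq\mathcal{T}_{\mathcal{M}}(x)$ (the tangent space of $\mathcal{M}$ at $x$); (ii) the graph $\{(x,v):v\in\Gamma(x)\}$ is closed relative to $\mathcal{M}\times\mathbb{R}^N$; (iii) there is $\rho>0$ with $\max\{|v|:v\in\Gamma(x)\}\le\rho(1+|x|)$ for all $x\in\mathcal M$. Trajectories are Lipschitz (absolutely continuous) arcs in $\mathcal{M}$ satisfying the inclusion a.e., and unless otherwise stated are defined on a maximal interval $[0,T)$; the escape time $\mathrm{Esc}(x(\cdot),\mathcal{M},\Gamma)$ is the $T$ for which either $T=+\infty$ or $x(t)$ approaches $\overline{\mathcal{M}}\setminus\mathcal{M}$ as $t\nearrow T$. $(\mathcal{M},\Gamma)$ is strongly invariant on $\mathcal{C}$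 if every trajectory $x(\cdot)$ with $x(0)\in\mathcal{M}\cap\mathcal{C}$ satisfies $x(t)\in\mathcal{C}$ for all $t\in[0,\mathrm{Esc}(x(\cdot),\mathcal{M},\Gamma))$. Euler arcs: given a selection $\gamma$ of $\Gamma$ (an arbitrary function with $\gamma(y)\in\Gamma(y)$ for all $y\in\mathcal{M}$), an initial point $x_0=x\in\mathcal{M}$ and a partition $\pi=\{0=t_0<t_1<\dots<t_\ell=T\}$ with norm $\|\pi\|=\max_n(t_n-t_{n-1})$ (small), define nodes recursively by $x_{n+1}=\mathrm{proj}_{\overline{\mathcal{M}}}[x_n+(t_{n+1}-t_n)\gamma(x_n)]$, the process terminating when $x_{n+1}\in\overline{\mathcal{M}}\setminus\mathcal{M}$. The Euler polygonal arc $x^\pi(\cdot)$ is the piecewise linear interpolation of these nodes (with $x^\pi(t_n)=x_n$). Euler arc property: for every solution $x(\cdot)$ of $\dot x(t)\in\Gamma(x(t))$ a.e. $t\in[0,T]$, $x(0)=x$, in $\mathcal{M}$, there exist a selection $\gamma$ of $\Gamma$ and partitions $\pi_m$ of $[0,T]$ with $\|\pi_m\|\to0$ such that the Euler polygonal arcs $x^{\pi_m}(\cdot)$ associated with $\gamma$ (starting at $x$) converge uniformly to $x(\cdot)$ on $[0,T]$. *)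

theory Defs
  imports "HOL-Analysis.Analysis"
begin

text \<open>
  The ambient space is an arbitrary Euclidean space \<open>'a\<close>, and \<open>infdist x C\<close> is the distance from
  \<open>x\<close> to \<open>C\<close>. A multifunction \<open>\<Gamma>\<close> on \<open>M\<close> is a total function into sets; its values outside \<open>M\<close>
  are never used.
\<close>

definition proj_set :: "'a::euclidean_space set \<Rightarrow> 'a \<Rightarrow> 'a set" where
  "proj_set C x = {c \<in> C. norm (x - c) = infdist x C}"

definition proximally_smooth :: "'a::euclidean_space set \<Rightarrow> real \<Rightarrow> bool" where
  "proximally_smooth S \<delta> \<longleftrightarrow> closed S \<and> \<delta> > 0 \<and>
     (\<exists>\<epsilon>>0. \<forall>x. 0 < infdist x S \<and> infdist x S < \<delta> + \<epsilon> \<longrightarrow>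
        (\<lambda>y. infdist y S) differentiable (at x))"

definition C2_on :: "'a::euclidean_space set \<Rightarrow> ('a \<Rightarrow> 'a) \<Rightarrow> bool" where
  "C2_on U f \<longleftrightarrow>
     (\<exists>(f' :: 'a \<Rightarrow> 'a \<Rightarrow>\<^sub>L 'a) (f'' :: 'a \<Rightarrow> 'a \<Rightarrow>\<^sub>L ('a \<Rightarrow>\<^sub>L 'a)).
        (\<forall>x\<in>U. (f has_derivative blinfun_apply (f' x)) (at x)) \<and>
        (\<forall>x\<in>U. (f' has_derivative blinfun_apply (f'' x)) (at x)) \<and>
        continuous_on U f'')"

text \<open>
  Embedded manifolds are described by slice charts: near each of its points, \<open>M\<close> is straightened
  to an open piece of a \<open>d\<close>-dimensional subspace by a \<open>C\<^sup>2\<close> diffeomorphism of the ambient space.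
\<close>

definition embedded_C2_manifold :: "'a::euclidean_space set \<Rightarrow> bool" where
  "embedded_C2_manifold M \<longleftrightarrow>
     (\<exists>d. \<forall>x\<in>M. \<exists>U V h g E.
        open U \<and> open V \<and> x \<in> U \<and> homeomorphism U V h g \<and> C2_on U h \<and> C2_on V g \<and>
        subspace E \<and> dim E = d \<and> h ` (U \<inter> M) = V \<inter> E)"

text \<open>Tangent vectors are the velocities of \<open>C\<^sup>1\<close> curves in \<open>M\<close>.\<close>

definition tangent_space :: "'a::euclidean_space set \<Rightarrow> 'a \<Rightarrow> 'a set" where
  "tangent_space M x =
     {v. \<exists>\<epsilon>>0. \<exists>c. c C1_differentiable_on {-\<epsilon><..<\<epsilon>} \<and> c ` {-\<epsilon><..<\<epsilon>} \<subseteq> M \<and> c 0 = x \<and>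
           (c has_vector_derivative v) (at 0)}"

text \<open>
  The supremum is a maximum whenever \<open>\<Gamma> x\<close> is nonempty and compact, which the standard
  hypotheses guarantee on \<open>M\<close>.
\<close>

definition Hamiltonian :: "('a::euclidean_space \<Rightarrow> 'a set) \<Rightarrow> 'a \<Rightarrow> 'a \<Rightarrow> real" where
  "Hamiltonian \<Gamma> x \<zeta> = (SUP v\<in>\<Gamma> x. v \<bullet> \<zeta>)"

definition standard_hypotheses ::
    "'a::euclidean_space set \<Rightarrow> ('a \<Rightarrow> 'a set) \<Rightarrow> bool" where
  "standard_hypotheses M \<Gamma> \<longleftrightarrow>
     (\<forall>x\<in>M. \<Gamma> x \<noteq> {} \<and> convex (\<Gamma> x) \<and> compact (\<Gamma> x) \<and> \<Gamma> x \<subseteq> tangent_space M x) \<and>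
     closedin (top_of_set (M \<times> UNIV)) {(x, v). x \<in> M \<and> v \<in> \<Gamma> x} \<and>
     (\<exists>\<rho>>0. \<forall>x\<in>M. \<forall>v\<in>\<Gamma> x. norm v \<le> \<rho> * (1 + norm x))"

definition abs_continuous_on_interval :: "real \<Rightarrow> real \<Rightarrow> (real \<Rightarrow> 'a::euclidean_space) \<Rightarrow> bool" where
  "abs_continuous_on_interval a b f \<longleftrightarrow>
     (\<forall>\<epsilon>>0. \<exists>\<delta>>0. \<forall>(n::nat) u v.
        (\<forall>i<n. a \<le> u i \<and> u i \<le> v i \<and> v i \<le> b) \<and>
        (\<forall>i<n. \<forall>j<n. i \<noteq> j \<longrightarrow> {u i<..<v i} \<inter> {u j<..<v j} = {}) \<and>
        (\<Sum>i<n. v i - u i) < \<delta> \<longrightarrow>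
        (\<Sum>i<n. norm (f (v i) - f (u i))) < \<epsilon>)"

text \<open>
  Arcs are absolutely continuous on compact subintervals of the time interval \<open>J\<close>. When \<open>M\<close> is
  bounded, the growth condition on \<open>\<Gamma>\<close> makes such a solution Lipschitz on \<open>J\<close>.
\<close>

definition solution_on ::
    "'a::euclidean_space set \<Rightarrow> ('a \<Rightarrow> 'a set) \<Rightarrow> real set \<Rightarrow> (real \<Rightarrow> 'a) \<Rightarrow> bool" where
  "solution_on M \<Gamma> J x \<longleftrightarrow>
     (\<forall>t\<in>J. x t \<in> M) \<and>
     (\<forall>a b. {a..b} \<subseteq> J \<longrightarrow> abs_continuous_on_interval a b x) \<and>
     (AE t in lebesgue. t \<in> J \<longrightarrow> (\<exists>v\<in>\<Gamma> (x t). (x has_vector_derivative v) (at t within J)))"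

definition trajectory ::
    "'a::euclidean_space set \<Rightarrow> ('a \<Rightarrow> 'a set) \<Rightarrow> ereal \<Rightarrow> (real \<Rightarrow> 'a) \<Rightarrow> bool" where
  "trajectory M \<Gamma> T x \<longleftrightarrow> 0 < T \<and> solution_on M \<Gamma> {t. 0 \<le> t \<and> ereal t < T} x"

text \<open>
  The escape time as a relation. A trajectory has at most one, since an arc in \<open>M\<close> that is
  continuous at \<open>T\<close> cannot have a left limit outside \<open>M\<close> there.
\<close>

definition has_escape_time ::
    "'a::euclidean_space set \<Rightarrow> ('a \<Rightarrow> 'a set) \<Rightarrow> (real \<Rightarrow> 'a) \<Rightarrow> ereal \<Rightarrow> bool" where
  "has_escape_time M \<Gamma> x T \<longleftrightarrow>
     trajectory M \<Gamma> T x \<and>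
     (T = \<infinity> \<or> (\<exists>p \<in> closure M - M. (x \<longlongrightarrow> p) (at_left (real_of_ereal T))))"

definition strongly_invariant ::
    "'a::euclidean_space set \<Rightarrow> ('a \<Rightarrow> 'a set) \<Rightarrow> 'a set \<Rightarrow> bool" where
  "strongly_invariant M \<Gamma> C \<longleftrightarrow>
     (\<forall>x T. has_escape_time M \<Gamma> x T \<and> x 0 \<in> M \<inter> C \<longrightarrow>
        (\<forall>t. 0 \<le> t \<and> ereal t < T \<longrightarrow> x t \<in> C))"

definition selection :: "'a::euclidean_space set \<Rightarrow> ('a \<Rightarrow> 'a set) \<Rightarrow> ('a \<Rightarrow> 'a) \<Rightarrow> bool" where
  "selection M \<Gamma> \<gamma> \<longleftrightarrow> (\<forall>y\<in>M. \<gamma> y \<in> \<Gamma> y)"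

definition time_partition :: "real \<Rightarrow> nat \<Rightarrow> (nat \<Rightarrow> real) \<Rightarrow> bool" where
  "time_partition T l \<tau> \<longleftrightarrow> \<tau> 0 = 0 \<and> \<tau> l = T \<and> (\<forall>n<l. \<tau> n < \<tau> (Suc n))"

definition mesh :: "nat \<Rightarrow> (nat \<Rightarrow> real) \<Rightarrow> real" where
  "mesh l \<tau> = Max ((\<lambda>n. \<tau> (Suc n) - \<tau> n) ` {..<l})"

text \<open>
  Requiring \<open>\<xi> n \<in> M\<close> for all \<open>n < l\<close> says that the process has not terminated before its last
  step, so that the arc is defined on the whole of \<open>[0,T]\<close>; the last node may lie in
  \<open>closure M - M\<close>. The projection is required to be a single point, which is automatic for
  short steps when \<open>closure M\<close> is proximally smooth.
\<close>

definition euler_nodes ::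
    "'a::euclidean_space set \<Rightarrow> ('a \<Rightarrow> 'a) \<Rightarrow> 'a \<Rightarrow> nat \<Rightarrow> (nat \<Rightarrow> real) \<Rightarrow> (nat \<Rightarrow> 'a) \<Rightarrow> bool" where
  "euler_nodes M \<gamma> x0 l \<tau> \<xi> \<longleftrightarrow>
     \<xi> 0 = x0 \<and>
     (\<forall>n<l. \<xi> n \<in> M \<and>
        proj_set (closure M) (\<xi> n + (\<tau> (Suc n) - \<tau> n) *\<^sub>R \<gamma> (\<xi> n)) = {\<xi> (Suc n)})"

definition euler_arc ::
    "'a::euclidean_space set \<Rightarrow> ('a \<Rightarrow> 'a) \<Rightarrow> 'a \<Rightarrow> nat \<Rightarrow> (nat \<Rightarrow> real) \<Rightarrow> (real \<Rightarrow> 'a) \<Rightarrow> bool" where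
  "euler_arc M \<gamma> x0 l \<tau> y \<longleftrightarrow>
     (\<exists>\<xi>. euler_nodes M \<gamma> x0 l \<tau> \<xi> \<and>
        (\<forall>n<l. \<forall>s\<in>{\<tau> n..\<tau> (Suc n)}.
           y s = \<xi> n + ((s - \<tau> n) / (\<tau> (Suc n) - \<tau> n)) *\<^sub>R (\<xi> (Suc n) - \<xi> n)))"

definition euler_arc_property ::
    "'a::euclidean_space set \<Rightarrow> ('a \<Rightarrow> 'a set) \<Rightarrow> bool" where
  "euler_arc_property M \<Gamma> \<longleftrightarrow>
     (\<forall>T>0. \<forall>x. solution_on M \<Gamma> {0..T} x \<longrightarrow>
        (\<exists>\<gamma> l \<tau> y. selection M \<Gamma> \<gamma> \<and>
           (\<forall>m. time_partition T (l m) (\<tau> m)) \<and>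
           (\<lambda>m. mesh (l m) (\<tau> m)) \<longlonglongrightarrow> 0 \<and>
           (\<forall>m. euler_arc M \<gamma> (x 0) (l m) (\<tau> m) (y m)) \<and>
           uniform_limit {0..T} y x sequentially))"

end

theory Submission
  imports Defs
begin

text \<open>
  Fix a time \<open>s\<close> at which \<open>x\<close> has a velocity \<open>v \<in> \<Gamma> (x s)\<close> and let \<open>c\<close> be a point of \<open>C\<close>
  nearest to \<open>x s\<close>. Then \<open>exp (-2 * \<kappa> * r) * (infdist (x r) C)\<^sup>2\<close> is at most
  \<open>exp (-2 * \<kappa> * r) * (norm (x r - c))\<^sup>2\<close>, with equality at \<open>r = s\<close>, and the derivative of the latter
  at \<open>s\<close> is a positive multiple of \<open>v \<bullet> (x s - c) - \<kappa> * (infdist (x s) C)\<^sup>2 \<le> 0\<close>. Hence the former is an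
  absolutely continuous function whose upper right Dini derivative is nonpositive almost everywhere,
  and such a function does not increase.
\<close>

section \<open>Absolutely continuous functions\<close>

lemma abs_continuous_on_intervalE:
  fixes f :: "real \<Rightarrow> 'a::euclidean_space"
  assumes "abs_continuous_on_interval a b f" and "e > 0"
  obtains d where "d > 0" and "\<forall>(n::nat) u v.
        (\<forall>i<n. a \<le> u i \<and> u i \<le> v i \<and> v i \<le> b) \<and>
        (\<forall>i<n. \<forall>j<n. i \<noteq> j \<longrightarrow> {u i<..<v i} \<inter> {u j<..<v j} = {}) \<and>
        (\<Sum>i<n. v i - u i) < d \<longrightarrow> (\<Sum>i<n. norm (f (v i) - f (u i))) < e"
  using assms(1)[unfolded abs_continuous_on_interval_def, THEN spec, THEN mp, OF assms(2)]
  by (elim exE conjE) (rule that)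

text \<open>Serves to pass from the arc to the exponentially weighted squared distance:
  \<open>A\<close> accounts for the Lipschitz weight, \<open>B\<close> for the change of the squared
  distance with the arc.\<close>

lemma abs_continuous_on_intervalI_dominated:
  fixes f :: "real \<Rightarrow> 'a::euclidean_space" and g :: "real \<Rightarrow> 'b::euclidean_space"
  assumes ac: "abs_continuous_on_interval a b f"
    and A: "A \<ge> 0" and B: "B \<ge> 0"
    and le: "\<And>u v. a \<le> u \<Longrightarrow> u \<le> v \<Longrightarrow> v \<le> b \<Longrightarrow>
               norm (g v - g u) \<le> A * (v - u) + B * norm (f v - f u)"
  shows "abs_continuous_on_interval a b g"
  unfolding abs_continuous_on_interval_def
proof (intro allI impI)
  fix e :: real assume e: "e > 0"
  \<comment> \<open>Dividing by \<open>B + 1\<close> covers \<open>B = 0\<close> and makes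
    \<open>B * e'\<close> strictly less than \<open>e / 2\<close>; \<open>A + 1\<close> does the
    same below.\<close>
  define e' where "e' = e / (2 * (B + 1))"
  have e': "e' > 0" using e B by (simp add: e'_def)
  obtain d where d: "d > 0" and
    dd0: "\<forall>(n::nat) u v.
        (\<forall>i<n. a \<le> u i \<and> u i \<le> v i \<and> v i \<le> b) \<and>
        (\<forall>i<n. \<forall>j<n. i \<noteq> j \<longrightarrow> {u i<..<v i} \<inter> {u j<..<v j} = {}) \<and>
        (\<Sum>i<n. v i - u i) < d \<longrightarrow> (\<Sum>i<n. norm (f (v i) - f (u i))) < e'"
    by (rule abs_continuous_on_intervalE[OF ac e']) (rule that)
  note dd = dd0[THEN spec, THEN spec, THEN spec, THEN mp, OF conjI[OF _ conjI]]
  define d' where "d' = min d (e / (2 * (A + 1)))"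
  have "d' > 0" using d e A by (simp add: d'_def)
  moreover have "(\<Sum>i<n. norm (g (v i) - g (u i))) < e"
    if H: "(\<forall>i<n. a \<le> u i \<and> u i \<le> v i \<and> v i \<le> b) \<and>
        (\<forall>i<n. \<forall>j<n. i \<noteq> j \<longrightarrow> {u i<..<v i} \<inter> {u j<..<v j} = {}) \<and>
        (\<Sum>i<n. v i - u i) < d'" for n :: nat and u v
  proof -
    have "(\<Sum>i<n. norm (g (v i) - g (u i)))
        \<le> (\<Sum>i<n. A * (v i - u i) + B * norm (f (v i) - f (u i)))"
      using H le by (intro sum_mono) auto
    also have "\<dots> = A * (\<Sum>i<n. v i - u i) + B * (\<Sum>i<n. norm (f (v i) - f (u i)))"
      by (simp add: sum.distrib sum_distrib_left)
    also have "\<dots> \<le> A * (e / (2 * (A + 1))) + B * e'"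
      using H A B dd[of n u v] by (intro add_mono mult_left_mono) (auto simp: d'_def)
    also have "\<dots> < e"
    proof -
      have "A * (e / (2 * (A + 1))) < e / 2" "B * e' < e / 2"
        using e A B by (auto simp: e'_def field_simps)
      then show ?thesis by linarith
    qed
    finally show ?thesis .
  qed
  ultimately show "\<exists>\<delta>>0. \<forall>(n::nat) u v.
        (\<forall>i<n. a \<le> u i \<and> u i \<le> v i \<and> v i \<le> b) \<and>
        (\<forall>i<n. \<forall>j<n. i \<noteq> j \<longrightarrow> {u i<..<v i} \<inter> {u j<..<v j} = {}) \<and>
        (\<Sum>i<n. v i - u i) < \<delta> \<longrightarrow> (\<Sum>i<n. norm (g (v i) - g (u i))) < e"
    by blast
qed

lemma abs_continuous_on_interval_imp_continuous_on:
  fixes f :: "real \<Rightarrow> 'a::euclidean_space"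
  assumes "abs_continuous_on_interval a b f"
  shows "continuous_on {a..b} f"
  unfolding continuous_on_iff
proof (intro ballI allI impI)
  fix s e :: real assume s: "s \<in> {a..b}" and e: "e > 0"
  obtain d where d: "d > 0" and
    dd0: "\<forall>(n::nat) u v.
        (\<forall>i<n. a \<le> u i \<and> u i \<le> v i \<and> v i \<le> b) \<and>
        (\<forall>i<n. \<forall>j<n. i \<noteq> j \<longrightarrow> {u i<..<v i} \<inter> {u j<..<v j} = {}) \<and>
        (\<Sum>i<n. v i - u i) < d \<longrightarrow> (\<Sum>i<n. norm (f (v i) - f (u i))) < e"
    by (rule abs_continuous_on_intervalE[OF assms e]) (rule that)
  note dd = dd0[THEN spec, THEN spec, THEN spec, THEN mp, OF conjI[OF _ conjI]]
  have "dist (f r) (f s) < e" if r: "r \<in> {a..b}" "dist r s < d" for r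
    \<comment> \<open>A family of one interval suffices; \<open>min\<close> and \<open>max\<close>
      order its endpoints.\<close>
    using dd[of 1 "\<lambda>_. min r s" "\<lambda>_. max r s"] r s
    by (cases "r \<le> s") (auto simp: dist_norm norm_minus_commute)
  then show "\<exists>d>0. \<forall>r\<in>{a..b}. dist r s < d \<longrightarrow> dist (f r) (f s) < e"
    using d by blast
qed

section \<open>Monotonicity from a Dini bound almost everywhere\<close>

text \<open>Closed intervals may share endpoints, so additivity of measure is applied to their
  interiors, which are disjoint and have the same lengths.\<close>

lemma sum_length_le_measure:
  fixes u v :: "nat \<Rightarrow> real"
  assumes uv: "\<forall>i<n. u i \<le> v i \<and> {u i..v i} \<subseteq> U"
    and disj: "\<forall>i<n. \<forall>j<n. i \<noteq> j \<longrightarrow> {u i<..<v i} \<inter> {u j<..<v j} = {}"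
    and U: "U \<in> lmeasurable"
  shows "(\<Sum>i<n. v i - u i) \<le> measure lebesgue U"
proof -
  have "(\<Sum>i<n. v i - u i) = (\<Sum>i<n. measure lebesgue {u i<..<v i})"
    using uv by (intro sum.cong) auto
  also have "\<dots> = measure lebesgue (\<Union>i<n. {u i<..<v i})"
    using disj by (intro measure_UNION' [symmetric]) (auto simp: pairwise_def disjnt_def)
  also have "\<dots> \<le> measure lebesgue U"
    using uv U by (intro measure_mono_fmeasurable) force+
  finally show ?thesis .
qed

text \<open>Cover \<open>N\<close> by an open \<open>U\<close> so small that \<open>g\<close> varies
  by at most \<open>e\<close> over it. Outside \<open>U\<close> the function rises with slope at
  most \<open>e\<close>, inside \<open>U\<close> the rise is charged to the variation. A supremum
  argument carries the resulting bound from \<open>a\<close> to \<open>b\<close>, and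
  \<open>e\<close> tends to 0.\<close>

lemma abs_continuous_le_if_right_Dini_nonpos:
  fixes g :: "real \<Rightarrow> real"
  assumes ab: "a \<le> b" and ac: "abs_continuous_on_interval a b g" and N: "negligible N"
    and Dini: "\<And>s e. a \<le> s \<Longrightarrow> s < b \<Longrightarrow> s \<notin> N \<Longrightarrow> e > 0 \<Longrightarrow>
                 \<exists>\<eta>>0. \<forall>h. 0 < h \<and> h < \<eta> \<and> s + h \<le> b \<longrightarrow> g (s + h) \<le> g s + e * h"
  shows "g b \<le> g a"
proof -
  have main: "g b \<le> g a + e * (b - a) + e" if e: "e > 0" for e
  proof -
    obtain d where d: "d > 0" and
      dd0: "\<forall>(n::nat) u v.
        (\<forall>i<n. a \<le> u i \<and> u i \<le> v i \<and> v i \<le> b) \<and>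
        (\<forall>i<n. \<forall>j<n. i \<noteq> j \<longrightarrow> {u i<..<v i} \<inter> {u j<..<v j} = {}) \<and>
        (\<Sum>i<n. v i - u i) < d \<longrightarrow> (\<Sum>i<n. norm (g (v i) - g (u i))) < e"
      by (rule abs_continuous_on_intervalE[OF ac e]) (rule that)
    note dd = dd0[THEN spec, THEN spec, THEN spec, THEN mp, OF conjI[OF _ conjI]]
    obtain U where U: "open U" "N \<subseteq> U" "U \<in> lmeasurable" "measure lebesgue U < d"
    proof -
      obtain T where T: "open T" "N \<subseteq> T" "T - N \<in> lmeasurable" "emeasure lebesgue (T - N) < ennreal d"
        using sets_lebesgue_outer_open[OF negligible_imp_sets[OF N] d] by blast
      \<comment> \<open>Outer regularity only controls \<open>T - N\<close>; since \<open>N\<close>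
        is null, \<open>T\<close> itself is as small.\<close>
      have "T = (T - N) \<union> N" using T by auto
      then have "T \<in> lmeasurable" "measure lebesgue T \<le> measure lebesgue (T - N)"
        using T(3) N negligible_imp_measurable negligible_imp_measure0
          measure_Un_le[of "T - N" lebesgue N]
        by (metis fmeasurable.Un, metis add.right_neutral fmeasurableD)
      moreover have "measure lebesgue (T - N) < d"
        using T d by (simp add: emeasure_eq_measure2 ennreal_less_iff)
      ultimately show thesis using T that by force
    qed
    define fam where "fam s n u v \<longleftrightarrow>
        (\<forall>i<n. a \<le> u i \<and> u i \<le> v i \<and> v i \<le> s \<and> {u i..v i} \<subseteq> U) \<and>
        (\<forall>i<n. \<forall>j<n. i \<noteq> j \<longrightarrow> {u i<..<v i} \<inter> {u j<..<v j} = {})"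
      for s :: real and n :: nat and u v :: "nat \<Rightarrow> real"
    define W where "W s = {\<Sum>i<n. norm (g (v i) - g (u i)) | n u v. fam s n u v}" for s
    \<comment> \<open>The variation of \<open>g\<close> over \<open>U\<close> up to time \<open>s\<close>: its growth pays for the steps from the
      exceptional set, and it never exceeds \<open>e\<close>.\<close>
    define V where "V s = Sup (W s)" for s
    have fam_mono: "fam s n u v" if "fam r n u v" "r \<le> s" for r s n u v
    proof -
      have "\<forall>i<n. v i \<le> s" using that unfolding fam_def by (meson order_trans)
      then show ?thesis using that(1) unfolding fam_def by blast
    qed
    have W_less: "w < e" if in_W: "w \<in> W s" and "s \<le> b" for w s
    proof -
      obtain n u v where w: "w = (\<Sum>i<n. norm (g (v i) - g (u i)))" and f: "fam s n u v"
        using in_W unfolding W_def by blast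
      have fb: "fam b n u v" using f \<open>s \<le> b\<close> by (rule fam_mono)
      have "(\<Sum>i<n. v i - u i) \<le> measure lebesgue U"
        using f U(3) unfolding fam_def by (intro sum_length_le_measure) blast+
      then have "(\<Sum>i<n. v i - u i) < d" using U(4) by linarith
      then show ?thesis
        unfolding w using fb unfolding fam_def by (intro dd) blast+
    qed
    \<comment> \<open>The empty family, \<open>n = 0\<close>, keeps \<open>W s\<close> nonempty, so
      that its supremum is meaningful.\<close>
    have zero_W: "0 \<in> W s" for s
      unfolding W_def by (rule CollectI, rule exI[of _ 0]) (auto simp: fam_def)
    have bdd: "bdd_above (W s)" if "s \<le> b" for s
      using W_less that by (meson bdd_aboveI less_imp_le)
    have V_le: "V s \<le> e" if "s \<le> b" for s
      unfolding V_def using zero_W W_less that by (intro cSup_least) (auto intro: less_imp_le)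
    have V_nonneg: "0 \<le> V s" if "s \<le> b" for s
      unfolding V_def using zero_W bdd that by (intro cSup_upper) auto
    have V_mono: "V r \<le> V s" if "r \<le> s" "s \<le> b" for r s
    proof -
      have "W r \<subseteq> W s" using fam_mono[OF _ \<open>r \<le> s\<close>] unfolding W_def by blast
      then show ?thesis
        unfolding V_def using zero_W bdd that by (intro cSup_subset_mono) auto
    qed
    \<comment> \<open>A family that ends by time \<open>r\<close> stays nonoverlapping when the
      interval from \<open>r\<close> to \<open>s\<close> is appended as member number
      \<open>n\<close>.\<close>
    have V_step: "V r + norm (g s - g r) \<le> V s" if rs: "a \<le> r" "r \<le> s" "s \<le> b" "{r..s} \<subseteq> U" for r s
    proof -
      have "w \<le> V s - norm (g s - g r)" if in_W: "w \<in> W r" for w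
      proof -
        obtain n u v where w: "w = (\<Sum>i<n. norm (g (v i) - g (u i)))" and f: "fam r n u v"
          using in_W unfolding W_def by blast
        have fs: "fam s n u v" using f \<open>r \<le> s\<close> by (rule fam_mono)
        have v_le: "v i \<le> r" if "i < n" for i using f that by (simp add: fam_def)
        have "\<forall>i<Suc n. a \<le> (u(n := r)) i \<and> (u(n := r)) i \<le> (v(n := s)) i \<and> (v(n := s)) i \<le> s \<and>
                {(u(n := r)) i..(v(n := s)) i} \<subseteq> U"
          using fs rs unfolding fam_def less_Suc_eq by simp
        moreover have "{(u(n := r)) i<..<(v(n := s)) i} \<inter> {(u(n := r)) j<..<(v(n := s)) j} = {}"
          if ij: "i < Suc n" "j < Suc n" "i \<noteq> j" for i j
        proof -
          consider "i < n" "j < n" | "i = n" "j < n" | "i < n" "j = n"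
            using ij by linarith
          then show ?thesis
          proof cases
            case 1
            then show ?thesis using f ij(3) unfolding fam_def by simp
          next
            case 2
            then show ?thesis using v_le[of j] by auto
          next
            case 3
            then show ?thesis using v_le[of i] by auto
          qed
        qed
        ultimately have fam_Suc: "fam s (Suc n) (u(n := r)) (v(n := s))"
          unfolding fam_def by blast
        have sum_Suc: "(\<Sum>i<Suc n. norm (g ((v(n := s)) i) - g ((u(n := r)) i))) = w + norm (g s - g r)"
          by (simp add: w)
        have "w + norm (g s - g r) \<in> W s"
          unfolding W_def
          by (intro CollectI exI) (rule conjI [OF sum_Suc [symmetric] fam_Suc])
        then have "w + norm (g s - g r) \<le> V s"
          unfolding V_def using bdd rs by (intro cSup_upper) auto
        then show ?thesis by linarith
      qed
      then have "V r \<le> V s - norm (g s - g r)"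
        unfolding V_def[of r] using zero_W by (intro cSup_least) auto
      then show ?thesis by linarith
    qed
    define S where "S = {s \<in> {a..b}. g s \<le> g a + e * (s - a) + V s}"
    define c where "c = Sup S"
    have aS: "a \<in> S" using ab V_nonneg by (simp add: S_def)
    have bddS: "bdd_above S" by (auto simp: S_def)
    have S_le: "s \<le> c" if "s \<in> S" for s using that bddS by (simp add: c_def cSup_upper)
    have c: "a \<le> c" "c \<le> b"
      using S_le[OF aS] aS by (auto simp: c_def S_def intro!: cSup_least)
    \<comment> \<open>Continuity of \<open>V\<close> is not at hand. By monotonicity the right-hand
      side may be frozen at its value at \<open>c\<close>, after which continuity of
      \<open>g\<close> alone makes the set closed.\<close>
    have "c \<in> {s \<in> {a..b}. g s \<le> g a + e * (c - a) + V c}"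
      unfolding c_def
    proof (rule closed_subset_contains_Sup)
      show "closed {s \<in> {a..b}. g s \<le> g a + e * (Sup S - a) + V (Sup S)}"
        using continuous_on_closed_Collect_le
          [OF abs_continuous_on_interval_imp_continuous_on [OF ac] continuous_on_const closed_atLeastAtMost] .
      show "S \<subseteq> {s \<in> {a..b}. g s \<le> g a + e * (Sup S - a) + V (Sup S)}"
      proof
        fix s assume s: "s \<in> S"
        have "e * (s - a) \<le> e * (c - a)" "V s \<le> V c"
          using e S_le[OF s] V_mono c by auto
        then show "s \<in> {s \<in> {a..b}. g s \<le> g a + e * (Sup S - a) + V (Sup S)}"
          using s unfolding S_def c_def by auto
      qed
    qed (use aS bddS in auto)
    then have gc: "g c \<le> g a + e * (c - a) + V c" by simp
    have "c = b"
    proof (rule ccontr)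
      assume "c \<noteq> b"
      then have cb: "c < b" using c by simp
      \<comment> \<open>The bound can be pushed beyond \<open>c\<close>: in \<open>U\<close> the
        growth of \<open>V\<close> absorbs the increment of \<open>g\<close>, and outside
        \<open>U\<close> the point is not in \<open>N\<close>, so the Dini bound applies.\<close>
      have "\<exists>h>0. c + h \<le> b \<and> g (c + h) \<le> g c + e * h + (V (c + h) - V c)"
      proof (cases "c \<in> U")
        case True
        then obtain r where r: "r > 0" "cball c r \<subseteq> U"
          using U open_contains_cball by blast
        define h where "h = min r (b - c)"
        have h: "h > 0" "c + h \<le> b" using r cb by (auto simp: h_def)
        have "{c..c + h} \<subseteq> U" using r by (force simp: h_def dist_real_def)
        then have "V c + norm (g (c + h) - g c) \<le> V (c + h)"
          using h c by (intro V_step) auto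
        moreover have "0 < e * h" using e h by simp
        ultimately show ?thesis using h by (intro exI[of _ h]) auto
      next
        case False
        then obtain \<eta> where \<eta>: "\<eta> > 0" "\<And>h. 0 < h \<and> h < \<eta> \<and> c + h \<le> b \<Longrightarrow> g (c + h) \<le> g c + e * h"
          using Dini[of c e] U c cb e by blast
        define h where "h = min (\<eta> / 2) (b - c)"
        have h: "h > 0" "h < \<eta>" "c + h \<le> b" using \<eta> cb by (auto simp: h_def)
        then show ?thesis using \<eta>(2)[of h] V_mono[of c "c + h"] by (intro exI[of _ h]) auto
      qed
      then obtain h where h: "h > 0" "c + h \<le> b" "g (c + h) \<le> g c + e * h + (V (c + h) - V c)"
        by blast
      then have "c + h \<in> S" using gc c by (auto simp: S_def algebra_simps)
      then show False using S_le h by fastforce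
    qed
    then show ?thesis using gc V_le[of b] by simp
  qed
  show ?thesis
  proof (rule field_le_epsilon)
    fix e :: real assume e: "e > 0"
    \<comment> \<open>The total error in \<open>main\<close> is its parameter times
      \<open>b - a + 1\<close>.\<close>
    have "e / (b - a + 1) > 0" using e ab by simp
    from main[OF this] have "g b \<le> g a + e / (b - a + 1) * (b - a + 1)"
      by (simp only: distrib_left mult_1_right add.assoc)
    then show "g b \<le> g a + e" using ab by simp
  qed
qed

section \<open>Distance to \<open>C\<close> along a solution\<close>

text \<open>Compactness bounds the set of inner products, so each of them lies below the real
  supremum.\<close>

lemma inner_le_Hamiltonian:
  assumes "compact (\<Gamma> x)" "v \<in> \<Gamma> x"
  shows "v \<bullet> \<zeta> \<le> Hamiltonian \<Gamma> x \<zeta>"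
proof -
  have "compact ((\<lambda>w. w \<bullet> \<zeta>) ` \<Gamma> x)"
    using assms by (intro compact_continuous_image continuous_intros)
  then show ?thesis
    unfolding Hamiltonian_def using assms
    by (intro cSUP_upper bounded_imp_bdd_above compact_imp_bounded)
qed

text \<open>An arbitrary \<open>J\<close> containing the interval from 0 to \<open>t\<close> lets
  the bound apply to half-open time intervals of finite or infinite length.\<close>

lemma solution_infdist_bound:
  fixes M C :: "'a::euclidean_space set"
  assumes M: "bounded M" and comp: "\<And>y. y \<in> M \<Longrightarrow> compact (\<Gamma> y)"
    and C: "closed C" and \<kappa>: "\<kappa> > 0"
    and Ham: "\<And>y c. y \<in> M \<Longrightarrow> c \<in> proj_set C y \<Longrightarrow> Hamiltonian \<Gamma> y (y - c) \<le> \<kappa> * (infdist y C)\<^sup>2"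
    and sol: "solution_on M \<Gamma> J x" and t: "0 \<le> t" and J: "{0..t} \<subseteq> J"
  shows "infdist (x t) C \<le> exp (\<kappa> * t) * infdist (x 0) C"
proof (cases "C = {}")
  \<comment> \<open>By convention \<open>infdist\<close> to the empty set is 0, so both sides
    vanish.\<close>
  case True
  then show ?thesis by (simp add: infdist_def)
next
  case False
  define f where "f s = (infdist (x s) C)\<^sup>2" for s
  define g where "g s = exp (-2 * \<kappa> * s) * f s" for s
  have xM: "x s \<in> M" if "s \<in> {0..t}" for s
    using sol J that by (auto simp: solution_on_def)
  \<comment> \<open>Boundedness of \<open>M\<close> bounds the distance along the arc, which makes
    its square Lipschitz in the position.\<close>
  obtain R where R: "\<And>y. y \<in> M \<Longrightarrow> infdist y C \<le> R" "R \<ge> 0"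
  proof -
    obtain R where "R > 0" "\<And>y. y \<in> M \<Longrightarrow> norm y \<le> R" using M by (auto simp: bounded_pos)
    moreover obtain c where "c \<in> C" using False by blast
    ultimately show thesis
      by (intro that[of "R + norm c"])
        (auto intro!: infdist_le2[of c] norm_triangle_le_diff simp: dist_norm)
  qed
  have ac: "abs_continuous_on_interval 0 t g"
  proof (rule abs_continuous_on_intervalI_dominated)
    show "abs_continuous_on_interval 0 t x"
      using sol J by (auto simp: solution_on_def)
    show "0 \<le> 2 * \<kappa> * R\<^sup>2" "0 \<le> 2 * R" using \<kappa> R by auto
    fix u v :: real assume uv: "0 \<le> u" "u \<le> v" "v \<le> t"
    have d: "0 \<le> infdist (x u) C" "0 \<le> infdist (x v) C" "infdist (x u) C \<le> R" "infdist (x v) C \<le> R"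
      using R xM uv by (auto simp: infdist_nonneg)
    have "norm (f v - f u) = \<bar>infdist (x v) C + infdist (x u) C\<bar> * \<bar>infdist (x v) C - infdist (x u) C\<bar>"
      unfolding f_def by (simp add: power2_eq_square flip: abs_mult) (simp add: algebra_simps)
    also have "\<dots> \<le> (2 * R) * norm (x v - x u)"
      using d infdist_triangle_abs[of "x v" C "x u"] by (intro mult_mono) (auto simp: dist_norm)
    finally have f: "norm (f v - f u) \<le> (2 * R) * norm (x v - x u)" .
    \<comment> \<open>The weight is Lipschitz on nonnegative times, by
      \<open>1 - exp (-z) \<le> z\<close> with \<open>z = 2 * \<kappa> * (v - u)\<close>.\<close>
    have "exp (-2 * \<kappa> * u) - exp (-2 * \<kappa> * v) = exp (-2 * \<kappa> * u) * (1 - exp (-2 * \<kappa> * (v - u)))"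
      by (simp add: algebra_simps flip: exp_add)
    also have "\<dots> \<le> 1 * (2 * \<kappa> * (v - u))"
      using exp_ge_add_one_self[of "-2 * \<kappa> * (v - u)"] \<kappa> uv
      by (intro mult_mono) auto
    finally have ex: "exp (-2 * \<kappa> * u) - exp (-2 * \<kappa> * v) \<le> 2 * \<kappa> * (v - u)" by simp
    have "g v - g u = exp (-2 * \<kappa> * v) * (f v - f u) - (exp (-2 * \<kappa> * u) - exp (-2 * \<kappa> * v)) * f u"
      by (simp add: g_def algebra_simps)
    also have "norm \<dots> \<le> 1 * norm (f v - f u) + (2 * \<kappa> * (v - u)) * R\<^sup>2"
    proof -
      have "norm (exp (-2 * \<kappa> * v) * (f v - f u)) \<le> 1 * norm (f v - f u)"
        using \<kappa> uv by (simp add: abs_mult mult_left_le_one_le)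
      moreover have "exp (-2 * \<kappa> * v) \<le> exp (-2 * \<kappa> * u)" using \<kappa> uv by simp
      moreover have "0 \<le> f u" "f u \<le> R\<^sup>2" using d by (auto simp: f_def)
      ultimately show ?thesis
        using ex \<kappa> uv
        by (intro norm_triangle_le_diff add_mono) (auto simp: abs_mult intro!: mult_mono)
    qed
    finally show "norm (g v - g u) \<le> 2 * \<kappa> * R\<^sup>2 * (v - u) + 2 * R * norm (x v - x u)"
      using f by (simp add: algebra_simps)
  qed
  define N where "N = {s. \<not> (s \<in> J \<longrightarrow> (\<exists>v\<in>\<Gamma> (x s). (x has_vector_derivative v) (at s within J)))}"
  have N: "negligible N"
    using sol unfolding solution_on_def N_def by (auto simp: eventually_ae_filter_negligible intro: negligible_subset)
  have "g t \<le> g 0"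
  proof (rule abs_continuous_le_if_right_Dini_nonpos[OF t ac N])
    fix s e :: real assume s: "0 \<le> s" "s < t" "s \<notin> N" and e: "e > 0"
    have sJ: "s \<in> J" using s J by auto
    obtain v where v: "v \<in> \<Gamma> (x s)" "(x has_vector_derivative v) (at s within J)"
      using s sJ by (auto simp: N_def)
    obtain c where c: "c \<in> C" "infdist (x s) C = dist (x s) c"
      using infdist_attains_inf[OF C False] by blast
    have "v \<bullet> (x s - c) \<le> Hamiltonian \<Gamma> (x s) (x s - c)"
      using comp xM s v by (intro inner_le_Hamiltonian) auto
    also have "\<dots> \<le> \<kappa> * (infdist (x s) C)\<^sup>2"
      using c xM s by (intro Ham) (auto simp: proj_set_def dist_norm)
    finally have vc: "v \<bullet> (x s - c) \<le> \<kappa> * ((x s - c) \<bullet> (x s - c))"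
      by (simp add: c dist_norm power2_norm_eq_inner)
    \<comment> \<open>The square keeps \<open>\<phi>\<close> differentiable at \<open>s\<close> even
      when \<open>x s = c\<close>.\<close>
    define \<phi> where "\<phi> r = exp (-2 * \<kappa> * r) * ((x r - c) \<bullet> (x r - c))" for r
    define D where "D = exp (-2 * \<kappa> * s) * (2 * (v \<bullet> (x s - c)) - 2 * \<kappa> * ((x s - c) \<bullet> (x s - c)))"
    have "(\<phi> has_derivative (\<lambda>h. h * D)) (at s within J)"
      unfolding \<phi>_def[abs_def] D_def
      by (rule derivative_eq_intros v(2)[unfolded has_vector_derivative_def] refl | simp)+
        (simp add: fun_eq_iff algebra_simps inner_commute)
    then obtain \<eta> where \<eta>: "\<eta> > 0"
      "\<And>r. r \<in> J \<Longrightarrow> norm (r - s) < \<eta> \<Longrightarrow> norm (\<phi> r - \<phi> s - (r - s) * D) \<le> e * norm (r - s)"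
      using e unfolding has_derivative_within_alt by blast
    have D: "D \<le> 0" using vc by (simp add: D_def mult_nonneg_nonpos)
    have "g (s + h) \<le> g s + e * h" if h: "0 < h" "h < \<eta>" "s + h \<le> t" for h
    proof -
      have "(infdist (x (s + h)) C)\<^sup>2 \<le> (dist (x (s + h)) c)\<^sup>2"
        using c by (intro power_mono infdist_le infdist_nonneg)
      then have "g (s + h) \<le> \<phi> (s + h)"
        by (simp add: g_def \<phi>_def f_def dist_norm power2_norm_eq_inner)
      also have "\<dots> \<le> \<phi> s + h * D + e * h"
        using \<eta>(2)[of "s + h"] h s J by (auto simp: subset_iff)
      also have "\<phi> s = g s"
        by (simp add: g_def \<phi>_def f_def c dist_norm power2_norm_eq_inner)
      finally show ?thesis using D h mult_nonneg_nonpos[of h D] by simp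
    qed
    then show "\<exists>\<eta>>0. \<forall>h. 0 < h \<and> h < \<eta> \<and> s + h \<le> t \<longrightarrow> g (s + h) \<le> g s + e * h"
      using \<eta>(1) by blast
  qed
  then have "exp (2 * \<kappa> * t) * (exp (-2 * \<kappa> * t) * f t) \<le> exp (2 * \<kappa> * t) * f 0"
    by (simp add: g_def)
  then have "f t \<le> exp (2 * \<kappa> * t) * f 0"
    by (simp flip: mult.assoc exp_add)
  also have "\<dots> = (exp (\<kappa> * t) * infdist (x 0) C)\<^sup>2"
    by (simp add: f_def power_mult_distrib power2_eq_square flip: exp_add)
  finally show ?thesis
    unfolding f_def by (rule power2_le_imp_le) (simp add: infdist_nonneg)
qed

section \<open>Exponential bound for trajectories and strong invariance\<close>

theorem theorem4p1:
  fixes M C :: "'a::euclidean_space set"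
    and \<Gamma> :: "'a \<Rightarrow> 'a set"
    and \<delta> \<kappa> :: real
  assumes "bounded M"
    and "embedded_C2_manifold M"
    and "proximally_smooth (closure M) \<delta>"
    and "standard_hypotheses M \<Gamma>"
    and "euler_arc_property M \<Gamma>"
    and "closed C"
    and "\<kappa> > 0"
    and "\<And>x c. x \<in> M \<Longrightarrow> c \<in> proj_set C x \<Longrightarrow> Hamiltonian \<Gamma> x (x - c) \<le> \<kappa> * (infdist x C)\<^sup>2"
  shows "(\<forall>x0\<in>M. \<forall>T x. trajectory M \<Gamma> T x \<and> x 0 = x0 \<longrightarrow>
            (\<forall>t. 0 \<le> t \<and> ereal t < T \<longrightarrow> infdist (x t) C \<le> exp (\<kappa> * t) * infdist x0 C))
         \<and> strongly_invariant M \<Gamma> C"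
proof -
  have bound: "infdist (x t) C \<le> exp (\<kappa> * t) * infdist (x 0) C"
    if "trajectory M \<Gamma> T x" "0 \<le> t" "ereal t < T" for T x t
  proof (rule solution_infdist_bound)
    show "solution_on M \<Gamma> {t. 0 \<le> t \<and> ereal t < T} x"
      using that by (simp add: trajectory_def)
    show "{0..t} \<subseteq> {t. 0 \<le> t \<and> ereal t < T}"
      using that by (auto intro: le_less_trans[of _ "ereal t"])
  qed (use assms that in \<open>auto simp: standard_hypotheses_def\<close>)
  moreover have "strongly_invariant M \<Gamma> C"
    unfolding strongly_invariant_def
  proof (intro allI impI, elim conjE)
    fix x T t assume esc: "has_escape_time M \<Gamma> x T" and x0: "x 0 \<in> M \<inter> C"
      and t: "0 \<le> t" "ereal t < T"
    have "infdist (x t) C \<le> exp (\<kappa> * t) * infdist (x 0) C"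
      using bound esc t by (auto simp: has_escape_time_def)
    then have "infdist (x t) C = 0"
      using x0 infdist_nonneg[of "x t" C] by simp
    then show "x t \<in> C"
      \<comment> \<open>The point \<open>x 0\<close> shows that \<open>C\<close> is nonempty, so a
        zero distance does mean membership.\<close>
      using in_closed_iff_infdist_zero[OF \<open>closed C\<close>] x0 by blast
  qed
  ultimately show ?thesis by blast
qed

end
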